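(* Let $\lambda\ge0$, let $p,q\in\mathbb{R}^n$ with $\|p\|=\|q\|=1$ and $\langle p,q\rangle=0$, and let $$b_\lambda=p\otimes p\otimes p+\lambda\,(p\otimes q\otimes q+q\otimes p\otimes q+q\otimes q\otimes p)\in\mathbb{R}^n\otimes\mathbb{R}^n\otimes\mathbb{R}^n .$$ Let $\mathcal{M}_{b_\lambda}$ be the set of best rank-one approximations of $b_\lambda$ and let $v^*:=p\otimes p\otimes p$. Then: (a) if $\lambda\le\frac12$, then $\mathcal{M}_{b_\lambda}=\{v^*\}$; (b) if $\lambda>\frac12$, then $|\mathcal{M}_{b_\lambda}|=2$ and $v^*\notin\mathcal{M}_{b_\lambda}$.
   Context: For a tensor $b\in\bigotimes_{\mu=1}^d\mathbb{R}^{n_\mu}$ (Euclidean inner product), $\mathcal{M}_b$ denotes the set of best rank-one approximations of $b$, i.e. the set of all $v$ of the form $v=p_1\otimes\cdots\otimes p_d$, $p_\mu\in\mathbb{R}^{n_\mu}$, that minimise $\|b-v\|$ (equivalently, minimise $f(v)=\frac{1}{\|b\|^2}\left[\frac12\langle v,v\rangle-\langle b,v\rangle\right]$) over all tensors of this form. *)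

theory Defs
  imports "HOL-Analysis.Analysis"
begin

text \<open>
  Tensors of order three are represented by their coordinate arrays, with entries
  \<open>T $ i $ j $ k\<close>. The library's iterated inner product and norm on \<open>real^'c^'b^'a\<close> are the
  Euclidean ones of the tensor product, see \<open>inner_tensor3\<close> below.
\<close>

definition tensor3 :: "real^'a \<Rightarrow> real^'b \<Rightarrow> real^'c \<Rightarrow> real^'c^'b^'a" where
  "tensor3 x y z = (\<chi> i j k. x $ i * y $ j * z $ k)"

lemma inner_tensor3:
  "tensor3 x y z \<bullet> tensor3 x' y' z' = (x \<bullet> x') * (y \<bullet> y') * (z \<bullet> z')"
  by (simp add: tensor3_def inner_vec_def sum_product sum_distrib_left mult_ac)

text \<open>
  The factors are arbitrary vectors, so the zero tensor is included.
\<close>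

definition elementary_tensors :: "(real^'c^'b^'a) set" where
  "elementary_tensors = {tensor3 x y z | x y z. True}"

definition best_rank_one_approximations :: "real^'c^'b^'a \<Rightarrow> (real^'c^'b^'a) set" where
  "best_rank_one_approximations b =
     {v. is_arg_min (\<lambda>v. norm (b - v)) (\<lambda>v. v \<in> elementary_tensors) v}"

definition b_tensor :: "real \<Rightarrow> real^'n \<Rightarrow> real^'n \<Rightarrow> real^'n^'n^'n" where
  "b_tensor l p q =
     tensor3 p p p + l *\<^sub>R (tensor3 p q q + tensor3 q p q + tensor3 q q p)"

end

theory Submission
  imports Defs
begin

text \<open>
  For unit vectors \<open>y\<close>, \<open>z\<close> let \<open>w\<close> be the contraction of \<open>b\<close> with \<open>y\<close> and \<open>z\<close>. Completing the square
  gives \<open>\<parallel>b - x \<otimes> y \<otimes> z\<parallel>\<^sup>2 = \<parallel>b\<parallel>\<^sup>2 - \<parallel>w\<parallel>\<^sup>2 + \<parallel>x - w\<parallel>\<^sup>2\<close>, so the best approximations are the tensors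
  \<open>w \<otimes> y \<otimes> z\<close> for which \<open>\<parallel>w\<parallel>\<close> is maximal. With \<open>u = \<langle>p,y\<rangle>\<langle>p,z\<rangle>\<close> and \<open>v = \<langle>q,y\<rangle>\<langle>q,z\<rangle>\<close> one has
  \<open>\<bar>u\<bar> + \<bar>v\<bar> \<le> 1\<close> and hence, for \<open>t = \<bar>u\<bar> \<in> [0,1]\<close>,
  \<open>\<parallel>w\<parallel>\<^sup>2 \<le> \<lambda>\<^sup>2 + (1 + \<lambda>)(2\<lambda>t - (3\<lambda> - 1)t\<^sup>2)\<close>. The right-hand side is maximal only at \<open>t = 1\<close> if
  \<open>\<lambda> \<le> 1/2\<close>, and only at \<open>t = \<lambda>/(3\<lambda> - 1) < 1\<close> if \<open>\<lambda> > 1/2\<close>. In the second case equality in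
  \<open>\<bar>u\<bar> + \<bar>v\<bar> \<le> 1\<close> forces \<open>z = \<plusminus>y\<close>, and two choices are left for the line spanned by \<open>y\<close>.
\<close>

section \<open>Normalising the factors of an elementary tensor\<close>

lemma tensor3_scaleR:
  "tensor3 (r *\<^sub>R x) y z = r *\<^sub>R tensor3 x y z"
  "tensor3 x (r *\<^sub>R y) z = r *\<^sub>R tensor3 x y z"
  "tensor3 x y (r *\<^sub>R z) = r *\<^sub>R tensor3 x y z"
  by (simp_all add: tensor3_def vec_eq_iff)

lemma tensor3_zero [simp]:
  "tensor3 0 y z = 0" "tensor3 x 0 z = 0" "tensor3 x y 0 = 0"
  by (simp_all add: tensor3_def vec_eq_iff)

text \<open>The lengths of the second and third factor move into the first. If one of the two is
  zero, so is the tensor, and first factor 0 with arbitrary unit vectors serves.\<close>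

lemma elementary_tensor_unit_factors:
  fixes v :: "real^'c^'b^'a"
  assumes "v \<in> elementary_tensors"
  obtains x y z where "v = tensor3 x y z" "norm y = 1" "norm z = 1"
proof -
  obtain x y z where v: "v = tensor3 x y z"
    using assms by (auto simp: elementary_tensors_def)
  obtain e :: "real^'b" where e: "norm e = 1"
    using vector_choose_size[of 1] by auto
  obtain f :: "real^'c" where f: "norm f = 1"
    using vector_choose_size[of 1] by auto
  show thesis
  proof (cases "y = 0 \<or> z = 0")
    case True
    then have "v = tensor3 0 e f" by (auto simp: v)
    then show thesis using that e f by blast
  next
    case False
    then have "v = tensor3 ((norm y * norm z) *\<^sub>R x) (y /\<^sub>R norm y) (z /\<^sub>R norm z)"
      by (simp add: v tensor3_scaleR field_simps)
    then show thesis by (rule that) (use False in auto)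
  qed
qed

lemma norm_diff_square:
  fixes x y :: "'a::real_inner"
  shows "(norm (x - y))\<^sup>2 = (norm x)\<^sup>2 - 2 * (x \<bullet> y) + (norm y)\<^sup>2"
  by (simp add: dot_norm_neg field_simps)

text \<open>The equality case of Cauchy-Schwarz. The bound \<open>norm y \<le> 1\<close> instead of
  equality allows \<open>y\<close> to be the projection of a unit vector.\<close>

lemma unit_eq_scaleR_inner:
  fixes x y :: "'a::real_inner"
  assumes "norm x = 1" "norm y \<le> 1" "\<bar>x \<bullet> y\<bar> = 1"
  shows "x = (x \<bullet> y) *\<^sub>R y"
proof -
  have "(x \<bullet> y)\<^sup>2 = 1" using assms(3) by (metis one_power2 power2_abs)
  moreover have "(norm y)\<^sup>2 \<le> 1" using assms(2) by (simp add: power_le_one)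
  moreover have "(norm (x - (x \<bullet> y) *\<^sub>R y))\<^sup>2 = (norm x)\<^sup>2 - 2 * (x \<bullet> y)\<^sup>2 + (x \<bullet> y)\<^sup>2 * (norm y)\<^sup>2"
    unfolding power2_norm_eq_inner by (simp add: inner_diff inner_commute power2_eq_square)
  ultimately have "(norm (x - (x \<bullet> y) *\<^sub>R y))\<^sup>2 \<le> 0" using assms(1) by simp
  then show ?thesis by simp
qed

section \<open>Reduction to maximising the norm of the contraction\<close>

definition contraction :: "real \<Rightarrow> real^'n \<Rightarrow> real^'n \<Rightarrow> real^'n \<Rightarrow> real^'n \<Rightarrow> real^'n" where
  "contraction l p q y z =
     ((p \<bullet> y) * (p \<bullet> z) + l * ((q \<bullet> y) * (q \<bullet> z))) *\<^sub>R p
     + (l * ((p \<bullet> y) * (q \<bullet> z) + (q \<bullet> y) * (p \<bullet> z))) *\<^sub>R q"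

lemma inner_b_tensor: "b_tensor l p q \<bullet> tensor3 x y z = contraction l p q y z \<bullet> x"
  by (simp add: b_tensor_def contraction_def inner_tensor3 inner_add_left algebra_simps)

lemma contraction_scaleR:
  "contraction l p q (r *\<^sub>R y) z = r *\<^sub>R contraction l p q y z"
  "contraction l p q y (r *\<^sub>R z) = r *\<^sub>R contraction l p q y z"
  by (simp_all add: contraction_def algebra_simps)

lemma norm_b_tensor_diff:
  assumes "norm y = 1" "norm z = 1"
  shows "(norm (b_tensor l p q - tensor3 x y z))\<^sup>2 =
    (norm (b_tensor l p q))\<^sup>2 - (norm (contraction l p q y z))\<^sup>2
      + (norm (x - contraction l p q y z))\<^sup>2"
proof -
  have "(norm (tensor3 x y z))\<^sup>2 = (norm x)\<^sup>2"
    using assms by (simp add: power2_norm_eq_inner inner_tensor3 norm_eq_1)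
  then show ?thesis
    by (simp add: norm_diff_square inner_b_tensor inner_commute[of x "contraction l p q y z"])
qed

text \<open>By \<open>norm_b_tensor_diff\<close> the squared distance is at least
  \<open>(norm b)\<^sup>2 - m\<close>, with equality only if \<open>x\<close> is the contraction and
  its squared norm is \<open>m\<close>; the pair \<open>y0\<close>, \<open>z0\<close> shows that
  this distance is reached.\<close>

lemma best_rank_one_eq:
  assumes bound: "\<And>y z. norm y = 1 \<Longrightarrow> norm z = 1 \<Longrightarrow> (norm (contraction l p q y z))\<^sup>2 \<le> m"
    and attained: "norm y0 = 1" "norm z0 = 1" "(norm (contraction l p q y0 z0))\<^sup>2 = m"
  shows "best_rank_one_approximations (b_tensor l p q) =
    {tensor3 (contraction l p q y z) y z | y z.
       norm y = 1 \<and> norm z = 1 \<and> (norm (contraction l p q y z))\<^sup>2 = m}"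
    (is "?B = ?R")
proof -
  let ?b = "b_tensor l p q"
  have lower: "(norm ?b)\<^sup>2 - m \<le> (norm (?b - v))\<^sup>2" if v: "v \<in> elementary_tensors" for v
    using v
  proof (rule elementary_tensor_unit_factors)
    fix x y z assume "v = tensor3 x y z" "norm y = 1" "norm z = 1"
    then show ?thesis
      using bound[of y z] by (simp add: norm_b_tensor_diff add_increasing2)
  qed
  show ?thesis
  proof (intro equalityI subsetI)
    fix v assume "v \<in> ?B"
    then have v: "v \<in> elementary_tensors"
      and least: "\<And>u. u \<in> elementary_tensors \<Longrightarrow> norm (?b - v) \<le> norm (?b - u)"
      by (auto simp: best_rank_one_approximations_def is_arg_min_linorder)
    from v obtain x y z where xyz: "v = tensor3 x y z" "norm y = 1" "norm z = 1"
      by (rule elementary_tensor_unit_factors)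
    have "norm (?b - v) \<le> norm (?b - tensor3 (contraction l p q y0 z0) y0 z0)"
      by (rule least) (auto simp: elementary_tensors_def)
    then have "(norm (?b - v))\<^sup>2 \<le> (norm (?b - tensor3 (contraction l p q y0 z0) y0 z0))\<^sup>2"
      by (simp add: power_mono)
    also have "\<dots> = (norm ?b)\<^sup>2 - m"
      by (simp add: norm_b_tensor_diff attained)
    finally have le: "(norm (x - contraction l p q y z))\<^sup>2 \<le> (norm (contraction l p q y z))\<^sup>2 - m"
      using norm_b_tensor_diff[OF xyz(2,3), of l p q x] xyz(1) by simp
    with bound[OF xyz(2,3)] have "(norm (x - contraction l p q y z))\<^sup>2 \<le> 0" by linarith
    then have "x = contraction l p q y z" by simp
    with le bound[OF xyz(2,3)] xyz show "v \<in> ?R" by auto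
  next
    fix v assume "v \<in> ?R"
    then obtain y z where v: "v = tensor3 (contraction l p q y z) y z" "norm y = 1" "norm z = 1"
      "(norm (contraction l p q y z))\<^sup>2 = m" by blast
    have "norm (?b - v) \<le> norm (?b - u)" if "u \<in> elementary_tensors" for u
    proof (rule power2_le_imp_le)
      show "(norm (?b - v))\<^sup>2 \<le> (norm (?b - u))\<^sup>2"
        using lower[OF that] by (simp add: v norm_b_tensor_diff)
    qed simp
    moreover have "v \<in> elementary_tensors" using v(1) by (auto simp: elementary_tensors_def)
    ultimately show "v \<in> ?B"
      by (simp add: best_rank_one_approximations_def is_arg_min_linorder)
  qed
qed

section \<open>Bounds on the contraction for orthonormal p and q\<close>

context
  fixes l :: real and p q :: "real^'n"
  assumes l: "l \<ge> 0" and p: "norm p = 1" and q: "norm q = 1" and pq: "p \<bullet> q = 0"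
begin

lemma orthonormal [simp]: "p \<bullet> p = 1" "q \<bullet> q = 1" "p \<bullet> q = 0" "q \<bullet> p = 0"
  using p q pq by (simp_all add: norm_eq_1 inner_commute)

lemma norm_combination: "(norm (a *\<^sub>R p + b *\<^sub>R q))\<^sup>2 = a\<^sup>2 + b\<^sup>2"
  unfolding power2_norm_eq_inner by (simp add: inner_add power2_eq_square)

lemma bessel_pair: "(p \<bullet> y)\<^sup>2 + (q \<bullet> y)\<^sup>2 \<le> (norm y)\<^sup>2"
proof -
  have "(norm (y - ((p \<bullet> y) *\<^sub>R p + (q \<bullet> y) *\<^sub>R q)))\<^sup>2 = (norm y)\<^sup>2 - ((p \<bullet> y)\<^sup>2 + (q \<bullet> y)\<^sup>2)"
    unfolding power2_norm_eq_inner
    by (simp add: inner_diff inner_add inner_commute[of y p] inner_commute[of y q] power2_eq_square)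
  then show ?thesis by (metis diff_ge_0_iff_ge zero_le_power2)
qed

lemma abs_products_le_1:
  assumes "norm y = 1" "norm z = 1"
  shows "\<bar>(p \<bullet> y) * (p \<bullet> z)\<bar> + \<bar>(q \<bullet> y) * (q \<bullet> z)\<bar> \<le> 1"
proof -
  have "2 * \<bar>a * b\<bar> \<le> a\<^sup>2 + b\<^sup>2" for a b :: real
    using sum_squares_bound[of "\<bar>a\<bar>" "\<bar>b\<bar>"] by (simp add: abs_mult)
  from this[of "p \<bullet> y" "p \<bullet> z"] this[of "q \<bullet> y" "q \<bullet> z"] bessel_pair[of y] bessel_pair[of z] assms
  show ?thesis by simp
qed

text \<open>Exactly, the squared norm is the right-hand side with \<open>l\<^sup>2\<close>
  multiplied by the two Bessel sums of \<open>y\<close> and \<open>z\<close>, each at most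
  1.\<close>

lemma norm_contraction_le:
  fixes y z
  defines "u \<equiv> (p \<bullet> y) * (p \<bullet> z)" and "v \<equiv> (q \<bullet> y) * (q \<bullet> z)"
  assumes "norm y = 1" "norm z = 1"
  shows "(norm (contraction l p q y z))\<^sup>2 \<le> l\<^sup>2 + (1 + l) * ((1 - l) * u\<^sup>2 + 2 * l * (u * v))"
proof -
  have "((p \<bullet> y)\<^sup>2 + (q \<bullet> y)\<^sup>2) * ((p \<bullet> z)\<^sup>2 + (q \<bullet> z)\<^sup>2) \<le> 1 * 1"
    using bessel_pair[of y] bessel_pair[of z] assms by (intro mult_mono) auto
  then have "l\<^sup>2 * (((p \<bullet> y)\<^sup>2 + (q \<bullet> y)\<^sup>2) * ((p \<bullet> z)\<^sup>2 + (q \<bullet> z)\<^sup>2)) \<le> l\<^sup>2"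
    by (simp add: mult_left_le)
  moreover have "(norm (contraction l p q y z))\<^sup>2 =
      l\<^sup>2 * (((p \<bullet> y)\<^sup>2 + (q \<bullet> y)\<^sup>2) * ((p \<bullet> z)\<^sup>2 + (q \<bullet> z)\<^sup>2))
      + (1 + l) * ((1 - l) * u\<^sup>2 + 2 * l * (u * v))"
    unfolding contraction_def norm_combination u_def v_def
    by (simp add: power2_eq_square algebra_simps)
  ultimately show ?thesis by simp
qed

lemma product_le:
  fixes y z
  defines "u \<equiv> (p \<bullet> y) * (p \<bullet> z)" and "v \<equiv> (q \<bullet> y) * (q \<bullet> z)"
  assumes "norm y = 1" "norm z = 1"
  shows "u * v \<le> \<bar>u\<bar> * (1 - \<bar>u\<bar>)"
proof -
  have "u * v \<le> \<bar>u\<bar> * \<bar>v\<bar>" by (metis abs_ge_self abs_mult)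
  also have "\<dots> \<le> \<bar>u\<bar> * (1 - \<bar>u\<bar>)"
    using abs_products_le_1[of y z] assms by (intro mult_left_mono) auto
  finally show ?thesis .
qed

lemma norm_contraction_le_quadratic:
  fixes y z
  defines "t \<equiv> \<bar>(p \<bullet> y) * (p \<bullet> z)\<bar>"
  assumes "norm y = 1" "norm z = 1"
  shows "(norm (contraction l p q y z))\<^sup>2 \<le> l\<^sup>2 + (1 + l) * (2 * l * t - (3 * l - 1) * t\<^sup>2)"
proof -
  define u v where "u = (p \<bullet> y) * (p \<bullet> z)" and "v = (q \<bullet> y) * (q \<bullet> z)"
  have t: "t = \<bar>u\<bar>" "u\<^sup>2 = t\<^sup>2" by (simp_all add: t_def u_def)
  have "2 * l * (u * v) \<le> 2 * l * (t * (1 - t))"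
    using product_le[OF assms(2,3)] l by (simp add: u_def v_def t(1) mult_left_mono)
  then have "(1 - l) * t\<^sup>2 + 2 * l * (u * v) \<le> 2 * l * t - (3 * l - 1) * t\<^sup>2"
    by (simp add: power2_eq_square algebra_simps)
  then have "(1 - l) * u\<^sup>2 + 2 * l * (u * v) \<le> 2 * l * t - (3 * l - 1) * t\<^sup>2"
    by (simp only: t(2))
  then have "(1 + l) * ((1 - l) * u\<^sup>2 + 2 * l * (u * v)) \<le>
      (1 + l) * (2 * l * t - (3 * l - 1) * t\<^sup>2)"
    using l by (intro mult_left_mono) auto
  then show ?thesis using norm_contraction_le[OF assms(2,3)] by (simp add: u_def v_def)
qed

section \<open>The case of l at most 1/2\<close>

lemma best_rank_one_small:
  assumes half: "l \<le> 1/2"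
  shows "best_rank_one_approximations (b_tensor l p q) = {tensor3 p p p}"
proof -
  have key: "(norm (contraction l p q y z))\<^sup>2 \<le> 1 \<and>
      ((norm (contraction l p q y z))\<^sup>2 = 1 \<longrightarrow> \<bar>(p \<bullet> y) * (p \<bullet> z)\<bar> = 1)"
    if yz: "norm y = 1" "norm z = 1" for y z
  proof -
    define t where "t = \<bar>(p \<bullet> y) * (p \<bullet> z)\<bar>"
    have t: "0 \<le> t" "t \<le> 1" using abs_products_le_1[OF yz] by (auto simp: t_def)
    have "(norm (contraction l p q y z))\<^sup>2 \<le> l\<^sup>2 + (1 + l) * (2 * l * t - (3 * l - 1) * t\<^sup>2)"
      unfolding t_def by (rule norm_contraction_le_quadratic[OF yz])
    \<comment> \<open>The quadratic has value 1 at \<open>t = 1\<close>, so \<open>1 - t\<close>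
      splits off from the difference.\<close>
    also have "\<dots> = 1 - (1 + l) * ((1 - t) * ((1 - l) + (1 - 3 * l) * t))"
      by (simp add: power2_eq_square algebra_simps)
    finally have le: "(norm (contraction l p q y z))\<^sup>2 \<le>
      1 - (1 + l) * ((1 - t) * ((1 - l) + (1 - 3 * l) * t))" .
    show ?thesis
    proof (cases "t = 1")
      case True
      with le show ?thesis by (simp add: t_def)
    next
      case False
      \<comment> \<open>Linear interpolation between the values \<open>1 - l > 0\<close> at 0 and
        \<open>2 - 4 * l \<ge> 0\<close> at 1, hence positive for \<open>t < 1\<close>.\<close>
      have "(1 - l) + (1 - 3 * l) * t = (1 - l) * (1 - t) + (2 - 4 * l) * t"
        by (simp add: algebra_simps)
      moreover have "(1 - l) * (1 - t) > 0" using half t False by simp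
      moreover have "(2 - 4 * l) * t \<ge> 0" using half t by simp
      ultimately have "(1 + l) * ((1 - t) * ((1 - l) + (1 - 3 * l) * t)) > 0"
        using l t False by simp
      with le show ?thesis by simp
    qed
  qed
  have cp: "contraction l p q p p = p" by (simp add: contraction_def)
  have "best_rank_one_approximations (b_tensor l p q) =
    {tensor3 (contraction l p q y z) y z | y z.
       norm y = 1 \<and> norm z = 1 \<and> (norm (contraction l p q y z))\<^sup>2 = 1}"
    using key p cp by (intro best_rank_one_eq[of _ _ _ _ p p]) auto
  also have "\<dots> = {tensor3 p p p}"
  proof (intro equalityI subsetI)
    fix v assume "v \<in> {tensor3 (contraction l p q y z) y z | y z.
       norm y = 1 \<and> norm z = 1 \<and> (norm (contraction l p q y z))\<^sup>2 = 1}"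
    then obtain y z where v: "v = tensor3 (contraction l p q y z) y z"
      and yz: "norm y = 1" "norm z = 1" and "\<bar>(p \<bullet> y) * (p \<bullet> z)\<bar> = 1"
      using key by blast
    then have prod: "\<bar>y \<bullet> p\<bar> * \<bar>z \<bullet> p\<bar> = 1" by (simp add: inner_commute abs_mult)
    have le: "\<bar>y \<bullet> p\<bar> \<le> 1" "\<bar>z \<bullet> p\<bar> \<le> 1"
      using Cauchy_Schwarz_ineq2[of y p] Cauchy_Schwarz_ineq2[of z p] p yz by auto
    have "\<bar>y \<bullet> p\<bar> = 1" "\<bar>z \<bullet> p\<bar> = 1"
      using prod le mult_left_le[of "\<bar>z \<bullet> p\<bar>" "\<bar>y \<bullet> p\<bar>"] mult_left_le[of "\<bar>y \<bullet> p\<bar>" "\<bar>z \<bullet> p\<bar>"]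
      by (auto simp: mult.commute)
    then obtain a b where ab: "y = a *\<^sub>R p" "z = b *\<^sub>R p" "a\<^sup>2 = 1" "b\<^sup>2 = 1"
      using unit_eq_scaleR_inner[OF yz(1), of p] unit_eq_scaleR_inner[OF yz(2), of p] p
      by (metis order.refl one_power2 power2_abs)
    \<comment> \<open>Each sign occurs twice, once in its factor and once through the contraction,
      and cancels.\<close>
    have "v = (a\<^sup>2 * b\<^sup>2) *\<^sub>R tensor3 p p p"
      by (simp add: v ab(1,2) contraction_scaleR cp tensor3_scaleR power2_eq_square mult_ac)
    then show "v \<in> {tensor3 p p p}" using ab by simp
  qed (use p cp in \<open>force\<close>)
  finally show ?thesis .
qed

section \<open>The case of l above 1/2\<close>

lemma best_rank_one_large:
  assumes half: "l > 1/2"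
  defines "c \<equiv> sqrt (l / (3 * l - 1))" and "s \<equiv> sqrt (1 - l / (3 * l - 1))"
  shows "c > 0" "s > 0"
    and "best_rank_one_approximations (b_tensor l p q) =
      (\<lambda>y. tensor3 (contraction l p q y y) y y) ` {c *\<^sub>R p + s *\<^sub>R q, c *\<^sub>R p - s *\<^sub>R q}"
proof -
  \<comment> \<open>The vertex of the quadratic in \<open>t\<close>; \<open>m\<close> is its value
    there. For \<open>y = z\<close> one has \<open>t = (p \<bullet> y)\<^sup>2\<close>, hence the
    coordinates \<open>c\<close> and \<open>s\<close>.\<close>
  define r where "r = l / (3 * l - 1)"
  define m where "m = 4 * l ^ 3 / (3 * l - 1)"
  have r: "0 < r" "r < 1" using half by (auto simp: r_def)
  show "c > 0" "s > 0" using r by (simp_all add: c_def s_def flip: r_def)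
  have c2: "c\<^sup>2 = r" and s2: "s\<^sup>2 = 1 - r" using r by (simp_all add: c_def s_def flip: r_def)
  have lr: "(3 * l - 1) * r = l" using half by (simp add: r_def)
  have m: "m = l\<^sup>2 + (1 + l) * (l * r)"
    using half by (simp add: m_def r_def field_simps power2_eq_square power3_eq_cube)
  have square: "l\<^sup>2 + (1 + l) * (2 * l * t - (3 * l - 1) * t\<^sup>2)
      = m - (1 + l) * (3 * l - 1) * (t - r)\<^sup>2" for t
  proof -
    have "(3 * l - 1) * (t - r)\<^sup>2
        = (3 * l - 1) * t\<^sup>2 - 2 * ((3 * l - 1) * r) * t + ((3 * l - 1) * r) * r"
      by (simp add: power2_eq_square algebra_simps)
    then have "(3 * l - 1) * (t - r)\<^sup>2 = (3 * l - 1) * t\<^sup>2 - 2 * l * t + l * r"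
      by (simp only: lr)
    then show ?thesis by (simp add: m mult.assoc) (simp add: algebra_simps)
  qed
  have pos: "(1 + l) * (3 * l - 1) > 0" using half by simp
  have bound: "(norm (contraction l p q y z))\<^sup>2 \<le> m" if "norm y = 1" "norm z = 1" for y z
    using norm_contraction_le_quadratic[OF that] pos
    unfolding square by (smt (verit) mult_nonneg_nonneg zero_le_power2)
  \<comment> \<open>Stated for both signs of \<open>b\<close>, so that it covers the two candidate
    vectors.\<close>
  have unit: "norm (a *\<^sub>R p + b *\<^sub>R q) = 1 \<and>
      (norm (contraction l p q (a *\<^sub>R p + b *\<^sub>R q) (a *\<^sub>R p + b *\<^sub>R q)))\<^sup>2 = m"
    if ab: "a\<^sup>2 = r" "b\<^sup>2 = 1 - r" for a b
  proof
    have "(norm (a *\<^sub>R p + b *\<^sub>R q))\<^sup>2 = 1" unfolding norm_combination using ab by simp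
    then show "norm (a *\<^sub>R p + b *\<^sub>R q) = 1" by (simp add: power2_eq_1_iff) (smt (verit) norm_ge_zero)
    have "(norm (contraction l p q (a *\<^sub>R p + b *\<^sub>R q) (a *\<^sub>R p + b *\<^sub>R q)))\<^sup>2
        = (a\<^sup>2 + l * b\<^sup>2)\<^sup>2 + 4 * l\<^sup>2 * (a\<^sup>2 * b\<^sup>2)"
      unfolding contraction_def norm_combination
      by (simp add: inner_add_right power2_eq_square algebra_simps)
    also have "\<dots> = l\<^sup>2 + (1 + l) * (2 * l * r - (3 * l - 1) * r\<^sup>2)"
      unfolding ab by (simp add: power2_eq_square algebra_simps)
    also have "\<dots> = m" by (simp add: square)
    finally show "(norm (contraction l p q (a *\<^sub>R p + b *\<^sub>R q) (a *\<^sub>R p + b *\<^sub>R q)))\<^sup>2 = m" .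
  qed
  have plus: "norm (c *\<^sub>R p + s *\<^sub>R q) = 1 \<and>
      (norm (contraction l p q (c *\<^sub>R p + s *\<^sub>R q) (c *\<^sub>R p + s *\<^sub>R q)))\<^sup>2 = m"
    by (rule unit) (simp_all add: c2 s2)
  have minus: "norm (c *\<^sub>R p - s *\<^sub>R q) = 1 \<and>
      (norm (contraction l p q (c *\<^sub>R p - s *\<^sub>R q) (c *\<^sub>R p - s *\<^sub>R q)))\<^sup>2 = m"
    using unit[of c "- s"] by (simp add: c2 s2)
  have eqs: "\<exists>e d. e\<^sup>2 = 1 \<and> d\<^sup>2 = 1 \<and> z = e *\<^sub>R y \<and>
      y \<in> {d *\<^sub>R (c *\<^sub>R p + s *\<^sub>R q), d *\<^sub>R (c *\<^sub>R p - s *\<^sub>R q)}"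
    if yz: "norm y = 1" "norm z = 1" and eq: "(norm (contraction l p q y z))\<^sup>2 = m" for y z
  proof -
    define u v where "u = (p \<bullet> y) * (p \<bullet> z)" and "v = (q \<bullet> y) * (q \<bullet> z)"
    \<comment> \<open>Equality leaves no room for the square, which fixes
      \<open>\<bar>u\<bar>\<close>; the sharper bound in \<open>u\<close> and \<open>v\<close> then
      fixes \<open>u * v\<close>.\<close>
    have "m \<le> m - (1 + l) * (3 * l - 1) * (\<bar>u\<bar> - r)\<^sup>2"
      using norm_contraction_le_quadratic[OF yz] unfolding square eq u_def .
    then have "(1 + l) * (3 * l - 1) * (\<bar>u\<bar> - r)\<^sup>2 \<le> 0" by simp
    then have "(\<bar>u\<bar> - r)\<^sup>2 \<le> 0" using pos by (metis mult_le_0_iff not_less)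
    then have u: "\<bar>u\<bar> = r" by simp
    then have u2: "u\<^sup>2 = r\<^sup>2" by auto
    have "l\<^sup>2 + (1 + l) * (2 * l * r - (3 * l - 1) * r\<^sup>2) \<le>
        l\<^sup>2 + (1 + l) * ((1 - l) * u\<^sup>2 + 2 * l * (u * v))"
      using norm_contraction_le[OF yz] unfolding square eq u_def v_def by simp
    then have "2 * l * r - (3 * l - 1) * r\<^sup>2 \<le> (1 - l) * u\<^sup>2 + 2 * l * (u * v)"
      using l by simp
    then have "2 * l * (r * (1 - r)) \<le> 2 * l * (u * v)"
      unfolding u2 by (simp add: power2_eq_square algebra_simps)
    then have "r * (1 - r) \<le> u * v" using half by simp
    moreover have "u * v \<le> r * (1 - r)"
      using product_le[OF yz] u by (simp add: u_def v_def)
    ultimately have uv: "u * v = r * (1 - r)" by simp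
    \<comment> \<open>Since \<open>\<bar>u\<bar> = r > 0\<close>, this identity makes
      \<open>u + v\<close> a sign.\<close>
    have "u * (u + v) = r" using uv u2 by (simp add: power2_eq_square algebra_simps)
    then have sum: "\<bar>u + v\<bar> = 1" using u r by (metis abs_mult abs_of_pos mult_cancel_left2 less_irrefl)
    \<comment> \<open>The orthogonal projection onto the plane of \<open>p\<close> and
      \<open>q\<close>. As \<open>z \<bullet> P y = u + v\<close> has modulus 1, \<open>z\<close> is
      \<open>P y\<close> up to sign, and likewise \<open>y\<close> is \<open>P z\<close>; combining
      both shows that \<open>y\<close> lies in the plane.\<close>
    define P where "P x = (p \<bullet> x) *\<^sub>R p + (q \<bullet> x) *\<^sub>R q" for x
    have P: "norm (P x) \<le> 1" if "norm x = 1" for x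
    proof (rule power2_le_imp_le)
      show "(norm (P x))\<^sup>2 \<le> 1\<^sup>2"
        using bessel_pair[of x] that unfolding P_def norm_combination by simp
    qed simp
    have zP: "z \<bullet> P y = u + v" and yP: "y \<bullet> P z = u + v"
      by (simp_all add: P_def u_def v_def inner_add_right inner_commute mult_ac)
    have z: "z = (u + v) *\<^sub>R P y" using unit_eq_scaleR_inner[OF yz(2) P[OF yz(1)]] sum zP by simp
    have "y = (u + v) *\<^sub>R P z" using unit_eq_scaleR_inner[OF yz(1) P[OF yz(2)]] sum yP by simp
    also have "P z = (u + v) *\<^sub>R P y" by (simp add: z P_def inner_add_right algebra_simps)
    also have "(u + v) *\<^sub>R \<dots> = P y"
      using sum by (metis abs_mult_self_eq mult_1 scaleR_one scaleR_scaleR)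
    finally have y: "P y = y" by (rule sym)
    have ze: "z = (u + v) *\<^sub>R y" using z y by simp
    have e2: "(u + v)\<^sup>2 = 1" using sum by (metis one_power2 power2_abs)
    have "(p \<bullet> y)\<^sup>2 = \<bar>u\<bar>"
    proof -
      have "p \<bullet> z = (u + v) * (p \<bullet> y)" by (subst ze) simp
      then have "u = (u + v) * (p \<bullet> y)\<^sup>2" by (simp only: u_def power2_eq_square mult_ac)
      then show ?thesis using sum by (metis abs_mult abs_power2 mult_1)
    qed
    then have "(p \<bullet> y)\<^sup>2 = c\<^sup>2" by (simp add: u c2)
    moreover have "(p \<bullet> y)\<^sup>2 + (q \<bullet> y)\<^sup>2 = 1"
      using norm_combination[of "p \<bullet> y" "q \<bullet> y"] yz(1) by (simp add: y flip: P_def)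
    ultimately have "(p \<bullet> y)\<^sup>2 = c\<^sup>2" "(q \<bullet> y)\<^sup>2 = s\<^sup>2" by (simp_all add: c2 s2)
    then have "p \<bullet> y = c \<or> p \<bullet> y = - c" "q \<bullet> y = s \<or> q \<bullet> y = - s"
      by (simp_all add: power2_eq_iff)
    \<comment> \<open>The sign \<open>d\<close> is that of \<open>p \<bullet> y\<close>; the
      relative sign of \<open>q \<bullet> y\<close> selects the vector.\<close>
    then have "\<exists>d. d\<^sup>2 = 1 \<and> P y \<in> {d *\<^sub>R (c *\<^sub>R p + s *\<^sub>R q), d *\<^sub>R (c *\<^sub>R p - s *\<^sub>R q)}"
      by (elim disjE; intro exI[of _ "if p \<bullet> y = c then 1 else -1"])
        (auto simp: P_def algebra_simps)
    then show ?thesis using e2 ze unfolding y by blast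
  qed
  have "best_rank_one_approximations (b_tensor l p q) =
    {tensor3 (contraction l p q y z) y z | y z.
       norm y = 1 \<and> norm z = 1 \<and> (norm (contraction l p q y z))\<^sup>2 = m}"
    using plus by (intro best_rank_one_eq[OF bound, of "c *\<^sub>R p + s *\<^sub>R q" "c *\<^sub>R p + s *\<^sub>R q"]) simp_all
  also have "\<dots> = (\<lambda>y. tensor3 (contraction l p q y y) y y) `
      {c *\<^sub>R p + s *\<^sub>R q, c *\<^sub>R p - s *\<^sub>R q}" (is "?L = ?T ` ?Y")
  proof (intro equalityI subsetI)
    fix v assume "v \<in> ?L"
    then obtain y z where v: "v = tensor3 (contraction l p q y z) y z"
      and "norm y = 1" "norm z = 1" "(norm (contraction l p q y z))\<^sup>2 = m" by blast
    then obtain e d y' where *: "e\<^sup>2 = 1" "d\<^sup>2 = 1" "z = e *\<^sub>R y" "y = d *\<^sub>R y'" "y' \<in> ?Y"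
      using eqs[of y z] by blast
    \<comment> \<open>\<open>d\<close> enters through both factors and twice through the
      contraction, \<open>e\<close> once in each, so all signs cancel.\<close>
    have "v = ((d\<^sup>2 * d\<^sup>2) * e\<^sup>2) *\<^sub>R ?T y'"
      by (simp add: v *(3,4) contraction_scaleR tensor3_scaleR power2_eq_square mult_ac)
    also have "\<dots> = ?T y'" by (simp add: *(1,2))
    finally show "v \<in> ?T ` ?Y" using *(5) by (rule image_eqI)
  next
    fix v assume "v \<in> ?T ` ?Y"
    then show "v \<in> ?L" using plus minus by auto
  qed
  finally show "best_rank_one_approximations (b_tensor l p q) =
      (\<lambda>y. tensor3 (contraction l p q y y) y y) ` {c *\<^sub>R p + s *\<^sub>R q, c *\<^sub>R p - s *\<^sub>R q}" .
qed

end

section \<open>Combining the cases and separating the tensors\<close>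

theorem proposition1p4:
  fixes l :: real and p q :: "real^'n"
  assumes "l \<ge> 0"
    and "norm p = 1" and "norm q = 1" and "p \<bullet> q = 0"
  shows "(l \<le> 1/2 \<longrightarrow>
            best_rank_one_approximations (b_tensor l p q) = {tensor3 p p p}) \<and>
         (l > 1/2 \<longrightarrow>
            card (best_rank_one_approximations (b_tensor l p q)) = 2 \<and>
            tensor3 p p p \<notin> best_rank_one_approximations (b_tensor l p q))"
proof (rule conjI; rule impI)
  assume "l \<le> 1/2"
  then show "best_rank_one_approximations (b_tensor l p q) = {tensor3 p p p}"
    by (rule best_rank_one_small[OF assms])
next
  assume half: "l > 1/2"
  define c s where "c = sqrt (l / (3 * l - 1))" and "s = sqrt (1 - l / (3 * l - 1))"
  define T where "T y = tensor3 (contraction l p q y y) y y" for y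
  have cs: "c > 0" "s > 0" and best: "best_rank_one_approximations (b_tensor l p q) =
      {T (c *\<^sub>R p + s *\<^sub>R q), T (c *\<^sub>R p - s *\<^sub>R q)}"
    using best_rank_one_large[OF assms half] by (simp_all add: c_def s_def T_def)
  note pq = orthonormal[OF assms]
  have coeff: "tensor3 q p p \<bullet> T (c *\<^sub>R p + e *\<^sub>R q) = 2 * l * c ^ 3 * e" for e
    by (simp add: T_def inner_tensor3 contraction_def inner_add_right pq power3_eq_cube)
  \<comment> \<open>The sign of the coefficient of \<open>q \<otimes> p \<otimes> p\<close> separates the three tensors.\<close>
  have "tensor3 q p p \<bullet> T (c *\<^sub>R p + s *\<^sub>R q) > 0"
    using coeff[of s] cs half by simp
  moreover have "tensor3 q p p \<bullet> T (c *\<^sub>R p - s *\<^sub>R q) < 0"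
    using coeff[of "- s"] cs half by simp
  moreover have "tensor3 q p p \<bullet> tensor3 p p p = 0"
    by (simp add: inner_tensor3 pq)
  ultimately have ne: "T (c *\<^sub>R p + s *\<^sub>R q) \<noteq> T (c *\<^sub>R p - s *\<^sub>R q)"
    and "tensor3 p p p \<notin> {T (c *\<^sub>R p + s *\<^sub>R q), T (c *\<^sub>R p - s *\<^sub>R q)}"
    by auto
  then show "card (best_rank_one_approximations (b_tensor l p q)) = 2 \<and>
      tensor3 p p p \<notin> best_rank_one_approximations (b_tensor l p q)"
    by (simp add: best)
qed

end
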